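(* Let $L$ be a prime coprime to the characteristic $p$ of the finite field $\mathbb{F}_q$, where $q=p^d$ with $d\ge1$, and assume that $\delta_L(p)\mid d$. Let $f$ denote the map $x\mapsto x^L$, and let $n\ge 1$. A matrix $A\in \mathrm{M}_n(q)$ is periodic under $f$ if and only if all eigenvalues of $A$ (in an algebraic closure $\overline{\mathbb{F}_q}$) are periodic under $f$ and the Jordan canonical form of $A$ over $\overline{\mathbb{F}_q}$ has no nonzero nilpotent block (that is, no Jordan block of size at least $2$ with eigenvalue $0$). In particular, a matrix $A\in\mathrm{GL}_n(q)$ is periodic under $f$ if and only if all its eigenvalues are periodic under $f$.
   Context: $\mathrm{M}_n(q)$ is the algebra of $n\times n$ matrices over $\mathbb{F}_q$, and $\mathrm{GL}_n(q)=\mathrm{M}_n(q)^\times$. For a set $S$ and a self-map $f:S\to S$, a point $\alpha\in S$ is periodic if $f^m(\alpha)=\alpha$ for some $m>1$, where $f^m$ is the $m$-fold composite; this is applied with $S=\mathrm{M}_n(q)$ (or $\mathrm{GL}_n(q)$) for matrices and $S=\overline{\mathbb{F}_q}$ for eigenvalues. $\delta_L(p)$ is the multiplicative order of $p$ modulo $L$. *)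

theory Defs
  imports
    "HOL-Algebra.Algebraic_Closure_Type"
    "HOL-Number_Theory.Number_Theory"
    "Jordan_Normal_Form.Jordan_Normal_Form_Uniqueness"
begin

text \<open>
  The convention \<open>m > 1\<close> also covers fixed points, since \<open>f x = x\<close> gives \<open>f (f x) = x\<close>.
\<close>
definition periodic_point :: "'s set \<Rightarrow> ('s \<Rightarrow> 's) \<Rightarrow> 's \<Rightarrow> bool" where
  "periodic_point S f x \<longleftrightarrow> f \<in> S \<rightarrow> S \<and> x \<in> S \<and> (\<exists>m>1. (f ^^ m) x = x)"

abbreviation to_ac_mat :: "'a::field mat \<Rightarrow> 'a alg_closure mat" where
  "to_ac_mat \<equiv> map_mat to_ac"

text \<open>
  \<^const>\<open>jordan_nf\<close> represents a Jordan canonical form by the list of its blocks, given as pairs of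
  a positive size and an eigenvalue. It does not matter which Jordan form is chosen
  (\<open>no_nonzero_nilpotent_block_iff\<close> below).
\<close>
definition no_nonzero_nilpotent_block :: "'a::field mat \<Rightarrow> bool" where
  "no_nonzero_nilpotent_block A \<longleftrightarrow>
     (\<exists>n_as. jordan_nf A n_as \<and> \<not> (\<exists>k\<ge>2. (k, 0) \<in> set n_as))"

lemma no_nonzero_nilpotent_block_iff:
  assumes "jordan_nf A n_as"
  shows "no_nonzero_nilpotent_block A \<longleftrightarrow> \<not> (\<exists>k\<ge>2. (k, 0) \<in> set n_as)"
  using assms jordan_nf_unique[OF assms] unfolding no_nonzero_nilpotent_block_def by blast

definition GL :: "'a::field itself \<Rightarrow> nat \<Rightarrow> 'a mat set" where
  "GL ty n = Units (ring_mat ty n ())"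

end

theory Submission
  imports
    Defs
    "Jordan_Normal_Form.Jordan_Normal_Form_Existence"
    "Jordan_Normal_Form.DL_Rank"
begin

text \<open>
  A matrix is periodic iff \<open>A ^ L ^ m = A\<close> for some \<open>m > 1\<close>, and this can be tested on the Jordan
  blocks over the algebraic closure. A nilpotent block of size at least \<open>2\<close> never returns to itself.
  Conversely, a block of size at most \<open>p ^ s\<close> with eigenvalue \<open>a\<close> becomes the scalar \<open>a ^ p ^ s\<close> when
  raised to the power \<open>p ^ s\<close>. If the eigenvalues are periodic, then the nonzero ones satisfy
  \<open>a ^ t = 1\<close> for a common \<open>t\<close> of the form \<open>L ^ M - 1\<close>, so the invertible blocks have order
  dividing \<open>p ^ s * t\<close>. This number is coprime to \<open>L\<close>, and any \<open>m > 1\<close> with \<open>L ^ m\<close> congruent to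
  \<open>1\<close> modulo it is a period.
\<close>

section \<open>Jordan normal forms over algebraically closed fields\<close>

lemma eigenvalue_exists:
  fixes A :: "'a :: alg_closed_field mat"
  assumes A: "A \<in> carrier_mat n n" and n: "n > 0"
  shows "\<exists>e. eigenvalue A e"
proof -
  have "degree (char_poly A) > 0"
    using degree_monic_char_poly[OF A] n by simp
  then obtain e where "poly (char_poly A) e = 0"
    using alg_closed_imp_poly_has_root by blast
  then show ?thesis
    using eigenvalue_root_char_poly[OF A] by blast
qed

text \<open>For changing to a basis that starts with a chosen eigenvector: \<open>v\<close> extends
  to a basis, and the matrix with these columns has full rank, hence nonzero determinant.\<close>

lemma invertible_completion:
  fixes v :: "'a :: field vec"
  assumes v: "v \<in> carrier_vec n" and v0: "v \<noteq> 0\<^sub>v n"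
  obtains W W' where "W \<in> carrier_mat n n" "W' \<in> carrier_mat n n"
    "W * W' = 1\<^sub>m n" "W' * W = 1\<^sub>m n" "col W 0 = v"
proof -
  interpret vec_space "TYPE('a)" n .
  define ws where "ws = basis_completion v"
  note bc = basis_completion[OF v v0, folded ws_def]
  define W where "W = mat_of_cols n ws"
  have W: "W \<in> carrier_mat n n"
    unfolding W_def using bc(6) by auto
  have cols: "cols W = ws"
    unfolding W_def using bc(2) by (rule cols_mat_of_cols)
  have "rank W = n"
    using lin_indpt_full_rank[OF W] cols bc(4,5) by simp
  then have "det W \<noteq> 0"
    using det_rank_iff[OF W] by blast
  from det_non_zero_imp_unit[OF W this, of "()"]
  obtain W' where W': "W' \<in> carrier_mat n n" "W * W' = 1\<^sub>m n" "W' * W = 1\<^sub>m n"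
    unfolding Units_def ring_mat_def by auto
  have n: "n > 0"
    using v v0 by (cases n) auto
  then have "col W 0 = ws ! 0"
    unfolding W_def using bc(2,6) by (subst col_mat_of_cols) auto
  also have "\<dots> = v"
    using bc(6,7) n by (cases ws) auto
  finally show ?thesis
    using that[OF W W'(1-3)] by blast
qed

text \<open>
  The existence theorem for Jordan normal forms in the AFP triangularizes by a Gram-Schmidt process,
  which needs an ordered field with conjugation. Over an algebraically closed field of positive
  characteristic we triangularize by completing an eigenvector to a basis instead.
\<close>
lemma similar_upper_triangular:
  fixes A :: "'a :: alg_closed_field mat"
  assumes "A \<in> carrier_mat n n"
  shows "\<exists>B. upper_triangular B \<and> similar_mat A B"
  using assms
proof (induction n arbitrary: A)
  case 0
  then have "upper_triangular A" by auto
  with similar_mat_refl[OF 0] show ?case by blast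
next
  case (Suc n)
  note A = Suc.prems
  obtain e where "eigenvalue A e"
    using eigenvalue_exists[OF A] by blast
  then obtain v where v: "v \<in> carrier_vec (Suc n)" "v \<noteq> 0\<^sub>v (Suc n)" "A *\<^sub>v v = e \<cdot>\<^sub>v v"
    using A unfolding eigenvalue_def eigenvector_def by auto
  obtain W W' where W: "W \<in> carrier_mat (Suc n) (Suc n)" and W': "W' \<in> carrier_mat (Suc n) (Suc n)"
    and WW': "W * W' = 1\<^sub>m (Suc n)" and W'W: "W' * W = 1\<^sub>m (Suc n)" and col: "col W 0 = v"
    using invertible_completion[OF v(1,2)] by metis
  define C where "C = W' * (A * W)"
  have AW: "A * W \<in> carrier_mat (Suc n) (Suc n)" using A W by simp
  have C: "C \<in> carrier_mat (Suc n) (Suc n)" unfolding C_def using W' AW by simp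
  have "W * C * W' = W * W' * (A * (W * W'))"
    unfolding C_def using A W W' by (simp add: assoc_mult_mat[of _ "Suc n" "Suc n" _ "Suc n" _ "Suc n"])
  then have "A = W * C * W'"
    using WW' A by simp
  then have AC: "similar_mat A C"
    using A W W' C WW' W'W by (intro similar_matI[of _ _ W W' "Suc n"]) auto
  \<comment> \<open>\<open>W'\<close> inverts \<open>W\<close> and \<open>v\<close> is column 0 of
    \<open>W\<close>, so \<open>W'\<close> sends \<open>v\<close> to the first unit vector. Hence
    column 0 of \<open>C\<close> is \<open>e\<close> times that vector, and \<open>C\<close> is
    block triangular with a 1x1 corner.\<close>
  have W'v: "W' *\<^sub>v v = unit_vec (Suc n) 0"
  proof -
    have "W' *\<^sub>v v = col (W' * W) 0"
      using W W' col by (subst col_mult2[of _ "Suc n" "Suc n" _ "Suc n"]) auto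
    then show ?thesis unfolding W'W by simp
  qed
  have "col C 0 = W' *\<^sub>v (A *\<^sub>v v)"
    unfolding C_def by (simp add: col_mult2[OF W' AW] col_mult2[OF A W] col)
  also have "\<dots> = e \<cdot>\<^sub>v unit_vec (Suc n) 0"
    unfolding v(3) W'v[symmetric] using W' v(1) by (rule mult_mat_vec)
  finally have col0: "C $$ (i, 0) = 0" if "0 < i" "i < Suc n" for i
    using that C by (auto simp: vec_eq_iff)
  obtain C1 C2 C3 C4 where split: "split_block C 1 1 = (C1, C2, C3, C4)"
    by (metis prod_cases4)
  have dims: "dim_row C = 1 + n" "dim_col C = 1 + n" using C by auto
  note sb = split_block[OF split dims]
  have "C3 = 0\<^sub>m n 1"
    using sb(3) col0 C split unfolding split_block_def Let_def by (intro eq_matI) auto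
  then have Cblock: "C = four_block_mat C1 C2 (0\<^sub>m n 1) C4" using sb(5) by simp
  obtain D where D: "upper_triangular D" "similar_mat C4 D"
    using Suc.IH[OF sb(4)] by blast
  have Dc: "D \<in> carrier_mat n n"
    using D(2) sb(4) similar_matD[OF D(2)] by auto
  \<comment> \<open>Conjugating only the lower right block keeps the corner and the zero block; the
    upper right block may change to some \<open>B0\<close>.\<close>
  obtain B0 where "similar_mat C (four_block_mat C1 B0 (0\<^sub>m n 1) D)"
    using similar_mat_four_block_0_ex[OF similar_mat_refl[OF sb(1)] D(2) sb(2,1,4)]
    unfolding Cblock by blast
  moreover have "upper_triangular C1"
    using sb(1) by auto
  then have "upper_triangular (four_block_mat C1 B0 (0\<^sub>m n 1) D)"
    using upper_triangular_four_block[OF sb(1) Dc _ D(1)] by blast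
  ultimately show ?case
    using similar_mat_trans[OF AC] by blast
qed

lemma jordan_nf_exists_alg_closed:
  fixes A :: "'a :: alg_closed_field mat"
  assumes A: "A \<in> carrier_mat n n"
  shows "\<exists>n_as. jordan_nf A n_as"
proof -
  obtain B where B: "upper_triangular B" "similar_mat A B"
    using similar_upper_triangular[OF A] by blast
  then have "B \<in> carrier_mat n n"
    using A similar_matD[OF B(2)] by auto
  from triangular_to_jnf_vector[OF this B(1)]
  show ?thesis
    using similar_mat_trans[OF B(2)] unfolding jordan_nf_def by blast
qed

text \<open>A block size is positive and is at most the multiplicity of its eigenvalue as a root of
  the characteristic polynomial.\<close>

lemma jordan_nf_eigenvalue:
  fixes A :: "'a :: field mat"
  assumes A: "A \<in> carrier_mat n n" and jnf: "jordan_nf A n_as" and mem: "(k, a) \<in> set n_as"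
  shows "eigenvalue A a"
proof -
  have "k \<noteq> 0"
    using jnf mem unfolding jordan_nf_def by force
  moreover have "char_poly A \<noteq> 0"
    using degree_monic_char_poly[OF A] by auto
  ultimately have "poly (char_poly A) a = 0"
    using jordan_nf_block_size_order_bound[OF jnf mem] by (simp add: order_root)
  then show ?thesis
    using eigenvalue_root_char_poly[OF A] by blast
qed

section \<open>Powers of Jordan matrices\<close>

lemma four_block_mat_inject:
  assumes "four_block_mat A B C D = four_block_mat A' B' C' D'"
    and "dim_row A = dim_row A'" "dim_col A = dim_col A'"
    and "dim_row D = dim_row D'" "dim_col D = dim_col D'"
  shows "A = A' \<and> D = D'"
proof
  let ?M = "four_block_mat A B C D" and ?M' = "four_block_mat A' B' C' D'"
  show "A = A'"
  proof (rule eq_matI)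
    fix i j assume "i < dim_row A'" "j < dim_col A'"
    then have "A $$ (i, j) = ?M $$ (i, j)" "A' $$ (i, j) = ?M' $$ (i, j)"
      using assms(2-5) by auto
    then show "A $$ (i, j) = A' $$ (i, j)" using assms(1) by simp
  qed (use assms in auto)
  show "D = D'"
  proof (rule eq_matI)
    fix i j assume "i < dim_row D'" "j < dim_col D'"
    then have "D $$ (i, j) = ?M $$ (i + dim_row A, j + dim_col A)"
      "D' $$ (i, j) = ?M' $$ (i + dim_row A', j + dim_col A')"
      using assms(2-5) by auto
    then show "D $$ (i, j) = D' $$ (i, j)" using assms(1-3) by simp
  qed (use assms in auto)
qed

text \<open>Equal dimensions make the blocks on both sides occupy the same positions, so they can be
  peeled off one at a time.\<close>

lemma diag_block_mat_map_inject:
  assumes "diag_block_mat (map f xs) = diag_block_mat (map g xs)"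
    and "\<And>x. dim_row (f x) = dim_row (g x)" "\<And>x. dim_col (f x) = dim_col (g x)"
    and "x \<in> set xs"
  shows "f x = g x"
  using assms(1,4)
proof (induction xs)
  case (Cons y ys)
  have "f y = g y \<and> diag_block_mat (map f ys) = diag_block_mat (map g ys)"
    using Cons.prems(1) assms(2,3)
    by (intro four_block_mat_inject) (auto simp: Let_def dim_diag_block_mat o_def)
  then show ?case using Cons by auto
qed simp

section \<open>Matrix powers, and Jordan blocks in prime characteristic\<close>

lemma pow_mat_mult:
  fixes A :: "'a :: semiring_1 mat"
  assumes A: "A \<in> carrier_mat n n"
  shows "A ^\<^sub>m (i * j) = (A ^\<^sub>m i) ^\<^sub>m j"
proof -
  interpret semiring "ring_mat TYPE('a) n ()" by (rule semiring_mat)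
  have "A \<in> carrier (ring_mat TYPE('a) n ())"
    using A by (simp add: ring_mat_simps)
  from nat_pow_pow[OF this, of i j] show ?thesis
    unfolding pow_mat_ring_pow[OF pow_carrier_mat[OF A], where b = "()"]
    unfolding pow_mat_ring_pow[OF A, where b = "()"] by (rule sym)
qed

lemma smult_one_pow_mat:
  "(c \<cdot>\<^sub>m 1\<^sub>m n :: 'a :: comm_semiring_1 mat) ^\<^sub>m k = c ^ k \<cdot>\<^sub>m 1\<^sub>m n"
  by (induction k) (auto simp: mult_smult_distrib[of _ n n _ n] mult_smult_assoc_mat[of _ n n _ n] intro!: eq_matI)

text \<open>From \<open>k * (n choose k) = n * (n - 1 choose (k - 1))\<close> with
  \<open>n = p ^ s\<close>: if \<open>p\<close> did not divide the binomial coefficient,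
  \<open>p ^ s\<close> would divide the smaller positive number \<open>k\<close>.\<close>

lemma prime_dvd_prime_power_choose:
  fixes p :: nat
  assumes p: "prime p" and k: "0 < k" "k < p ^ s"
  shows "p dvd (p ^ s choose k)"
proof (rule ccontr)
  assume "\<not> p dvd (p ^ s choose k)"
  then have "coprime (p ^ s) (p ^ s choose k)"
    using p by (simp add: prime_imp_coprime)
  moreover have "p ^ s dvd k * (p ^ s choose k)"
    using k by (simp add: times_binomial_minus1_eq)
  ultimately have "p ^ s dvd k"
    using coprime_dvd_mult_left_iff by blast
  then show False
    using k by (auto dest: dvd_imp_le)
qed

text \<open>An entry at distance \<open>j - i > 0\<close> above the diagonal carries the factor
  \<open>CHAR('a) ^ s choose (j - i)\<close>. As \<open>j - i < k\<close>, the bound on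
  \<open>k\<close> makes this factor vanish in the ring.\<close>

lemma jordan_block_pow_char:
  fixes a :: "'a :: comm_ring_1"
  assumes p: "prime CHAR('a)" and k: "k \<le> CHAR('a) ^ s"
  shows "jordan_block k a ^\<^sub>m (CHAR('a) ^ s) = a ^ (CHAR('a) ^ s) \<cdot>\<^sub>m 1\<^sub>m k"
proof (rule eq_matI)
  fix i j assume ij: "i < dim_row (a ^ CHAR('a) ^ s \<cdot>\<^sub>m 1\<^sub>m k)"
    "j < dim_col (a ^ CHAR('a) ^ s \<cdot>\<^sub>m 1\<^sub>m k)"
  have "of_nat (CHAR('a) ^ s choose (j - i)) = (0 :: 'a)" if "i < j"
    unfolding of_nat_eq_0_iff_char_dvd using that ij k
    by (intro prime_dvd_prime_power_choose[OF p]) auto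
  then show "(jordan_block k a ^\<^sub>m (CHAR('a) ^ s)) $$ (i, j) =
      (a ^ (CHAR('a) ^ s) \<cdot>\<^sub>m 1\<^sub>m k) $$ (i, j)"
    using ij by (auto simp: jordan_block_pow)
qed auto

lemma jordan_block_pow_eq_self:
  fixes a :: "'a :: comm_ring_1"
  assumes p: "prime CHAR('a)" and k: "k \<le> CHAR('a) ^ s" and a: "a ^ t = 1"
  shows "jordan_block k a ^\<^sub>m Suc (CHAR('a) ^ s * t) = jordan_block k a"
proof -
  have J: "jordan_block k a \<in> carrier_mat k k" by simp
  have "jordan_block k a ^\<^sub>m (CHAR('a) ^ s * t) = a ^ (CHAR('a) ^ s * t) \<cdot>\<^sub>m 1\<^sub>m k"
    by (simp add: pow_mat_mult[OF J] jordan_block_pow_char[OF p k] smult_one_pow_mat power_mult)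
  also have "\<dots> = 1\<^sub>m k"
    using a by (simp add: mult.commute[of _ t] power_mult) (intro eq_matI; simp)
  finally show ?thesis
    using J by simp
qed

lemma pow_mat_eq_self_imp_eigenvalue_pow:
  fixes A :: "'a :: field mat"
  assumes A: "A \<in> carrier_mat n n" and pow: "A ^\<^sub>m N = A" and ev: "eigenvalue A a"
  shows "a ^ N = a"
proof -
  obtain v where v: "eigenvector A v a"
    using ev unfolding eigenvalue_def by blast
  then have vc: "v \<in> carrier_vec n" "v \<noteq> 0\<^sub>v n" "A *\<^sub>v v = a \<cdot>\<^sub>v v"
    using A unfolding eigenvector_def by auto
  then have "a ^ N \<cdot>\<^sub>v v = a \<cdot>\<^sub>v v"
    using eigenvector_pow[OF A v, of N] pow by simp
  moreover obtain i where "i < n" "v $ i \<noteq> 0"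
    using vc(1,2) by (metis carrier_vecD eq_vecI index_zero_vec)
  ultimately show ?thesis
    using vc(1) by (metis carrier_vecD index_smult_vec(1) mult_cancel_right)
qed

text \<open>Conjugation commutes with powers, so \<open>A\<close> can be replaced by its Jordan
  matrix, whose powers are taken block by block.\<close>

lemma jordan_nf_pow_eq_self_iff:
  fixes A :: "'a :: field mat"
  assumes A: "A \<in> carrier_mat n n" and jnf: "jordan_nf A n_as"
  shows "A ^\<^sub>m N = A \<longleftrightarrow> (\<forall>(k, a) \<in> set n_as. jordan_block k a ^\<^sub>m N = jordan_block k a)"
proof -
  let ?J = "jordan_matrix n_as"
  obtain P Q where wit: "similar_mat_wit A ?J P Q"
    using jnf unfolding jordan_nf_def similar_mat_def by blast
  have "A ^\<^sub>m N = A \<longleftrightarrow> ?J ^\<^sub>m N = ?J"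
    using similar_mat_wit_pow_id[OF wit, of N] similar_mat_witD2(3)[OF A wit]
      similar_mat_wit_pow_id[OF similar_mat_wit_sym[OF wit], of N]
      similar_mat_witD(3)[OF refl similar_mat_wit_sym[OF wit]] by metis
  also have "\<dots> \<longleftrightarrow> (\<forall>(k, a) \<in> set n_as. jordan_block k a ^\<^sub>m N = jordan_block k a)"
  proof
    assume eq: "?J ^\<^sub>m N = ?J"
    let ?f = "\<lambda>(k, a). jordan_block k a ^\<^sub>m N" and ?g = "\<lambda>(k, a). jordan_block k a"
    have eq': "diag_block_mat (map ?f n_as) = diag_block_mat (map ?g n_as)"
      using eq unfolding jordan_matrix_pow unfolding jordan_matrix_def .
    have "?f x = ?g x" if "x \<in> set n_as" for x
      by (rule diag_block_mat_map_inject[OF eq' _ _ that]) (auto split: prod.splits)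
    then show "\<forall>(k, a) \<in> set n_as. jordan_block k a ^\<^sub>m N = jordan_block k a" by fast
  next
    assume "\<forall>(k, a) \<in> set n_as. jordan_block k a ^\<^sub>m N = jordan_block k a"
    then have "map (\<lambda>(k, a). jordan_block k a ^\<^sub>m N) n_as = map (\<lambda>(k, a). jordan_block k a) n_as"
      by (intro map_cong) auto
    then show "?J ^\<^sub>m N = ?J"
      unfolding jordan_matrix_pow by (simp only: jordan_matrix_def)
  qed
  finally show ?thesis .
qed

section \<open>Periodic points of the power map\<close>

lemma funpow_pow_mat:
  fixes A :: "'a :: semiring_1 mat"
  assumes A: "A \<in> carrier_mat n n"
  shows "((\<lambda>B. B ^\<^sub>m L) ^^ m) A = A ^\<^sub>m (L ^ m)"
  using A by (induction m) (simp_all add: pow_mat_mult[OF A, symmetric] mult.commute)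

lemma funpow_power:
  fixes x :: "'a :: monoid_mult"
  shows "((\<lambda>x. x ^ L) ^^ m) x = x ^ (L ^ m)"
  by (induction m) (simp_all add: power_mult[symmetric] mult.commute)

lemma periodic_point_power_iff:
  fixes x :: "'a :: monoid_mult"
  shows "periodic_point UNIV (\<lambda>x. x ^ L) x \<longleftrightarrow> (\<exists>m>1. x ^ (L ^ m) = x)"
  by (simp add: periodic_point_def funpow_power)

text \<open>Closure of \<open>S\<close> under the map is part of being periodic; the remaining
  condition does not mention \<open>S\<close>, which lets all matrices and the invertible ones be
  treated alike.\<close>

lemma periodic_point_pow_mat_iff:
  fixes A :: "'a :: semiring_1 mat"
  assumes "A \<in> S" "S \<subseteq> carrier_mat n n" "\<And>B. B \<in> S \<Longrightarrow> B ^\<^sub>m L \<in> S"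
  shows "periodic_point S (\<lambda>B. B ^\<^sub>m L) A \<longleftrightarrow> (\<exists>m>1. A ^\<^sub>m (L ^ m) = A)"
proof -
  have "A \<in> carrier_mat n n" using assms by blast
  from funpow_pow_mat[OF this] show ?thesis
    using assms unfolding periodic_point_def by simp
qed

lemma power_iterate_eq_self:
  fixes x :: "'a :: monoid_mult"
  assumes "x ^ (L ^ m) = x"
  shows "x ^ (L ^ (m * k)) = x"
  by (induction k) (simp_all add: power_add power_mult assms)

text \<open>Multiples of a period are again periods, so the product of the individual periods works
  for all of \<open>S\<close>.\<close>

lemma common_period:
  fixes f :: "'b \<Rightarrow> 'a :: monoid_mult"
  assumes "finite S" and "\<And>x. x \<in> S \<Longrightarrow> \<exists>m>0. f x ^ (L ^ m) = f x"
  shows "\<exists>M>0. \<forall>x \<in> S. f x ^ (L ^ M) = f x"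
  using assms
proof (induction S rule: finite_induct)
  case (insert x S)
  then obtain M where M: "M > 0" "\<forall>x \<in> S. f x ^ (L ^ M) = f x" by auto
  obtain m where m: "m > 0" "f x ^ (L ^ m) = f x" using insert.prems by auto
  have "f x ^ (L ^ (M * m)) = f x"
    using power_iterate_eq_self[OF m(2), of M] by (simp add: mult.commute)
  moreover have "f y ^ (L ^ (M * m)) = f y" if "y \<in> S" for y
    using M(2) that power_iterate_eq_self by blast
  ultimately show ?case
    using M(1) m(1) by (intro exI[of _ "M * m"]) auto
qed auto

lemma pow_mat_periodic_iff:
  fixes A :: "'a :: alg_closed_field mat"
  assumes A: "A \<in> carrier_mat n n" and p: "prime CHAR('a)"
    and L: "L > 1" "coprime L CHAR('a)"
  shows "(\<exists>m>1. A ^\<^sub>m (L ^ m) = A) \<longleftrightarrow>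
    (\<forall>a. eigenvalue A a \<longrightarrow> (\<exists>m>1. a ^ (L ^ m) = a)) \<and> no_nonzero_nilpotent_block A"
proof -
  obtain n_as where jnf: "jordan_nf A n_as"
    using jordan_nf_exists_alg_closed[OF A] by blast
  note blocks = jordan_nf_pow_eq_self_iff[OF A jnf] and
    nil_iff = no_nonzero_nilpotent_block_iff[OF jnf]
  show ?thesis
  proof
    assume "\<exists>m>1. A ^\<^sub>m (L ^ m) = A"
    then obtain m where m: "m > 1" "A ^\<^sub>m (L ^ m) = A" by blast
    have "L ^ m > 1" using L(1) m(1) by (intro one_less_power) auto
    have False if k: "k \<ge> 2" "(k, 0) \<in> set n_as" for k
    proof -
      \<comment> \<open>The \<open>N\<close>-th power of a nilpotent block has its ones on the
        \<open>N\<close>-th superdiagonal. Since \<open>L ^ m > 1\<close>, entry (0, 1) drops from 1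
        to 0.\<close>
      have "jordan_block k (0 :: 'a) ^\<^sub>m (L ^ m) = jordan_block k 0"
        using m(2) k(2) unfolding blocks by blast
      from arg_cong[OF this, of "\<lambda>B. B $$ (0, 1)"] show False
        using k(1) \<open>L ^ m > 1\<close> by (simp add: jordan_block_zero_pow)
    qed
    then show "(\<forall>a. eigenvalue A a \<longrightarrow> (\<exists>m>1. a ^ (L ^ m) = a)) \<and> no_nonzero_nilpotent_block A"
      using pow_mat_eq_self_imp_eigenvalue_pow[OF A m(2)] m(1) nil_iff by blast
  next
    assume "(\<forall>a. eigenvalue A a \<longrightarrow> (\<exists>m>1. a ^ (L ^ m) = a)) \<and> no_nonzero_nilpotent_block A"
    then have per: "\<forall>a. eigenvalue A a \<longrightarrow> (\<exists>m>1. a ^ (L ^ m) = a)"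
      and nil: "\<not> (\<exists>k\<ge>2. (k, 0) \<in> set n_as)"
      using nil_iff by simp_all
    have "\<exists>m>0. snd x ^ (L ^ m) = snd x" if "x \<in> set n_as" for x
    proof -
      have "eigenvalue A (snd x)"
        using jordan_nf_eigenvalue[OF A jnf, of "fst x" "snd x"] that by simp
      then obtain m where "m > 1" "snd x ^ (L ^ m) = snd x" using per by blast
      then show ?thesis by (intro exI[of _ m]) simp
    qed
    then obtain M where M: "M > 0" "\<forall>x \<in> set n_as. snd x ^ (L ^ M) = snd x"
      using common_period[of "set n_as" snd L] by auto
    \<comment> \<open>One exponent for all blocks: each size is at most \<open>s\<close>, and
      \<open>s < 2 ^ s \<le> CHAR('a) ^ s\<close>.\<close>
    define s where "s = sum_list (map fst n_as)"
    define t where "t = L ^ M - 1"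
    have "L ^ M > 1" using L(1) M(1) by (rule one_less_power)
    then have t: "t > 0" "L ^ M = Suc t" unfolding t_def by auto
    \<comment> \<open>\<open>Suc t\<close> is a positive power of \<open>L\<close>, so
      \<open>t\<close> is coprime to \<open>L\<close>.\<close>
    have "coprime t (Suc t)" by simp
    then have "coprime L t"
      using M(1) unfolding t(2)[symmetric] by (simp add: coprime_commute)
    then have "coprime L (CHAR('a) ^ s * t)"
      using L(2) by simp
    \<comment> \<open>Euler's theorem, squared: the totient may be 1, but the exponent must exceed
      1.\<close>
    then have cong: "[L ^ (totient (CHAR('a) ^ s * t) * 2) = 1] (mod CHAR('a) ^ s * t)"
      using cong_pow[OF euler_theorem, of L "CHAR('a) ^ s * t" 2] by (simp add: power_mult)
    define m where "m = totient (CHAR('a) ^ s * t) * 2"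
    have "CHAR('a) ^ s * t > 0"
      using t(1) p by (simp add: prime_gt_0_nat)
    then have "totient (CHAR('a) ^ s * t) > 0"
      by simp
    then have m: "m > 1"
      unfolding m_def by linarith
    have "CHAR('a) ^ s * t dvd L ^ m - 1"
      using cong L(1) unfolding m_def by (simp add: cong_altdef_nat cong_sym)
    then obtain q where q: "L ^ m - 1 = CHAR('a) ^ s * t * q" by blast
    have "L ^ m = Suc (L ^ m - 1)" using L(1) by simp
    then have Lm: "L ^ m = Suc (CHAR('a) ^ s * (t * q))"
      unfolding q by (simp only: mult.assoc)
    have "jordan_block k a ^\<^sub>m (L ^ m) = jordan_block k a" if ka: "(k, a) \<in> set n_as" for k a
    proof (cases "a = 0")
      case True
      \<comment> \<open>With eigenvalue 0 only the zero block of size at most 1 remains, and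
        positive powers fix it.\<close>
      then have k: "k \<le> 1" using nil ka by (metis Suc_1 not_less_eq_eq)
      have "L ^ m > 0" using L(1) by simp
      with True k show ?thesis
        by (auto simp: jordan_block_zero_pow intro!: eq_matI)
    next
      case False
      have "a ^ Suc t = a" using M(2) ka t(2) by fastforce
      then have "a ^ (t * q) = 1" using False by (simp add: power_mult)
      moreover have "k \<le> s"
        unfolding s_def using ka by (intro member_le_sum_list) (force, simp)
      then have "k \<le> CHAR('a) ^ s"
        using less_exp[of s] power_mono[OF prime_ge_2_nat[OF p], of s] by linarith
      ultimately show ?thesis
        unfolding Lm by (intro jordan_block_pow_eq_self[OF p]) auto
    qed
    then have "A ^\<^sub>m (L ^ m) = A" unfolding blocks by blast
    with m show "\<exists>m>1. A ^\<^sub>m (L ^ m) = A" by blast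
  qed
qed

section \<open>Passage from the finite field to its algebraic closure\<close>

lemma inj_comm_ring_hom_to_ac: "inj_comm_ring_hom (to_ac :: 'a::field \<Rightarrow> 'a alg_closure)"
  by unfold_locales auto

lemma to_ac_mat_pow_eq_self_iff:
  assumes "A \<in> carrier_mat n n"
  shows "to_ac_mat A ^\<^sub>m N = to_ac_mat A \<longleftrightarrow> A ^\<^sub>m N = A"
proof -
  interpret inj_comm_ring_hom "to_ac :: 'a \<Rightarrow> 'a alg_closure"
    by (rule inj_comm_ring_hom_to_ac)
  show ?thesis
    unfolding mat_hom_pow[OF assms, symmetric] by (rule iffI[OF mat_hom_inj arg_cong])
qed

text \<open>The embedding is injective and commutes with \<open>det\<close>, so the determinant
  stays nonzero; an eigenvector for 0 would lie in the kernel.\<close>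

lemma GL_no_zero_eigenvalue:
  fixes A :: "'a :: field mat"
  assumes "A \<in> GL TYPE('a) n"
  shows "\<not> eigenvalue (to_ac_mat A) 0"
proof
  assume ev: "eigenvalue (to_ac_mat A) 0"
  interpret inj_comm_ring_hom "to_ac :: 'a \<Rightarrow> 'a alg_closure"
    by (rule inj_comm_ring_hom_to_ac)
  have zero_smult: "0 \<cdot>\<^sub>v v = 0\<^sub>v n" if "v \<in> carrier_vec n" for v :: "'a alg_closure vec"
    using that by (intro eq_vecI) auto
  have A: "A \<in> carrier_mat n n"
    using assms unfolding GL_def Units_def by (auto simp: ring_mat_simps)
  have "det A \<noteq> 0"
    using assms unfolding GL_def by (rule unit_imp_det_non_zero)
  then have "det (to_ac_mat A) \<noteq> 0"
    by (simp add: hom_det)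
  moreover have Ac: "to_ac_mat A \<in> carrier_mat n n" using A by simp
  ultimately show False
    using ev det_0_iff_vec_prod_zero[OF Ac] A zero_smult
    unfolding eigenvalue_def eigenvector_def by auto
qed

theorem proposition3p1:
  fixes L p d n :: nat
  assumes "p = CHAR('a::{field, finite})"
    and "card (UNIV :: 'a set) = p ^ d" and "d \<ge> 1"
    and "prime L" and "coprime L p"
    and "ord L p dvd d"
    and "n \<ge> 1"
  shows "(\<forall>A \<in> (carrier_mat n n :: 'a mat set).
            periodic_point (carrier_mat n n) (\<lambda>B. B ^\<^sub>m L) A \<longleftrightarrow>
              (\<forall>a. eigenvalue (to_ac_mat A) a \<longrightarrow> periodic_point UNIV (\<lambda>x. x ^ L) a) \<and>
              no_nonzero_nilpotent_block (to_ac_mat A)) \<and>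
         (\<forall>A \<in> GL TYPE('a) n.
            periodic_point (GL TYPE('a) n) (\<lambda>B. B ^\<^sub>m L) A \<longleftrightarrow>
              (\<forall>a. eigenvalue (to_ac_mat A) a \<longrightarrow> periodic_point UNIV (\<lambda>x. x ^ L) a))"
proof -
  have p: "prime CHAR('a alg_closure)"
    using prime_CHAR_semidom[where ?'a = 'a] finite_imp_CHAR_pos[where ?'a = 'a] by simp
  have L: "L > 1" "coprime L CHAR('a alg_closure)"
    using assms(1,5) prime_gt_1_nat[OF assms(4)] by simp_all
  have iff: "(\<exists>m>1. A ^\<^sub>m (L ^ m) = A) \<longleftrightarrow>
      (\<forall>a. eigenvalue (to_ac_mat A) a \<longrightarrow> periodic_point UNIV (\<lambda>x. x ^ L) a) \<and>
      no_nonzero_nilpotent_block (to_ac_mat A)"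
    if A: "A \<in> carrier_mat n n" for A :: "'a mat"
    using pow_mat_periodic_iff[of "to_ac_mat A" n, OF _ p L] A
    by (simp add: periodic_point_power_iff to_ac_mat_pow_eq_self_iff[OF A])
  have GL_sub: "GL TYPE('a) n \<subseteq> carrier_mat n n"
    unfolding GL_def Units_def by (auto simp: ring_mat_simps)
  have GL_pow: "B ^\<^sub>m L \<in> GL TYPE('a) n" if B: "B \<in> GL TYPE('a) n" for B
  proof -
    interpret semiring "ring_mat TYPE('a) n ()" by (rule semiring_mat)
    have "B \<in> carrier_mat n n" using B GL_sub by blast
    from pow_mat_ring_pow[OF this, of L "()"] show ?thesis
      using B Units_pow_closed unfolding GL_def by simp
  qed
  \<comment> \<open>Any block with eigenvalue 0 would make 0 an eigenvalue, so the block condition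
    is automatic for invertible matrices.\<close>
  have no_nil: "no_nonzero_nilpotent_block (to_ac_mat A)" if A: "A \<in> GL TYPE('a) n" for A
  proof -
    have Ac: "to_ac_mat A \<in> carrier_mat n n" using A GL_sub by auto
    obtain n_as where jnf: "jordan_nf (to_ac_mat A) n_as"
      using jordan_nf_exists_alg_closed[OF Ac] by blast
    show ?thesis
      using jordan_nf_eigenvalue[OF Ac jnf] GL_no_zero_eigenvalue[OF A]
      unfolding no_nonzero_nilpotent_block_iff[OF jnf] by blast
  qed
  show ?thesis
  proof (intro conjI ballI)
    fix A :: "'a mat" assume A: "A \<in> carrier_mat n n"
    show "periodic_point (carrier_mat n n) (\<lambda>B. B ^\<^sub>m L) A \<longleftrightarrow>
        (\<forall>a. eigenvalue (to_ac_mat A) a \<longrightarrow> periodic_point UNIV (\<lambda>x. x ^ L) a) \<and>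
        no_nonzero_nilpotent_block (to_ac_mat A)"
      unfolding iff[OF A, symmetric] by (rule periodic_point_pow_mat_iff[OF A]) auto
  next
    fix A :: "'a mat" assume A: "A \<in> GL TYPE('a) n"
    then have "A \<in> carrier_mat n n" using GL_sub by blast
    from iff[OF this] no_nil[OF A] periodic_point_pow_mat_iff[OF A GL_sub GL_pow]
    show "periodic_point (GL TYPE('a) n) (\<lambda>B. B ^\<^sub>m L) A \<longleftrightarrow>
        (\<forall>a. eigenvalue (to_ac_mat A) a \<longrightarrow> periodic_point UNIV (\<lambda>x. x ^ L) a)"
      by simp
  qed
qed

end
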